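(* In the timed process algebra T-AWN, the parallel operator $\langle\!\langle$ on parallel process expressions is associative up to strong bisimilarity: $(P\langle\!\langle Q)\langle\!\langle S$ is strongly bisimilar to $P\langle\!\langle(Q\langle\!\langle S)$ for all parallel process expressions $P,Q,S$. The network parallel operator $\|$ on partial network expressions is associative and commutative up to strong bisimilarity: $(M_1\|M_2)\|M_3$ is strongly bisimilar to $M_1\|(M_2\|M_3)$, and $M_1\|M_2$ is strongly bisimilar to $M_2\|M_1$, for all partial network expressions $M_1,M_2,M_3$.
   Context: Strong bisimilarity is taken with respect to the labelled transition relation generated by the rules below. The transitions of parallel process expressions arise from transitions of their sequential components $\xi,p$, whose actions are $\tau$, $R{:}\mathbf{*cast}(m)$, $\mathbf{send}(m)$, $\mathbf{deliver}(d)$, $\mathbf{receive}(m)$, wait actions $w_1\in\mathcal{W}=\{\mathrm{w},\mathrm{wr},\mathrm{ws},\mathrm{wrs}\}$, and transmission actions $R{:}w_1$ ($R\subseteq\mathrm{IP}$). Only the following rules for composed expressions matter. Parallel process expressions: $PP::=\xi,SP\mid PP\langle\!\langle PP$. Partial function $\langle\!\langle$ on $\mathcal{W}$ (left argument from $P$, right from $Q$): - $\mathrm{w}\langle\!\langle(\mathrm{w},\mathrm{wr},\mathrm{ws},\mathrm{wrs})=(\mathrm{w},\mathrm{wr},\mathrm{w},\mathrm{wr})$; - $\mathrm{wr}\langle\!\langle(\mathrm{w},\mathrm{wr})=(\mathrm{w},\mathrm{wr})$; - $\mathrm{ws}\langle\!\langle(\mathrm{w},\mathrm{wr},\mathrm{ws},\mathrm{wrs})=(\mathrm{ws},\mathrm{wrs},\mathrm{ws},\mathrm{wrs})$;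 - $\mathrm{wrs}\langle\!\langle(\mathrm{w},\mathrm{wr})=(\mathrm{ws},\mathrm{wrs})$; - all other combinations are undefined. Parallel rules: (i) if $P\xrightarrow{a}P'$ with $a$ not of the form $\mathbf{receive}(m)$, $a\notin\mathcal{W}$ and $a$ not of the form $R{:}w_1$, then $P\langle\!\langle Q\xrightarrow{a}P'\langle\!\langle Q$; (ii) if $Q\xrightarrow{a}Q'$ with $a$ not of the form $\mathbf{send}(m)$, $a\notin\mathcal{W}$ and $a$ not of the form $R{:}w_1$, then $P\langle\!\langle Q\xrightarrow{a}P\langle\!\langle Q'$; (iii) if $P\xrightarrow{\mathbf{receive}(m)}P'$ and $Q\xrightarrow{\mathbf{send}(m)}Q'$, then $P\langle\!\langle Q\xrightarrow{\tau}P'\langle\!\langle Q'$; (iv) if $P\xrightarrow{w_1}P'$ and $Q\xrightarrow{w_2}Q'$, then $P\langle\!\langle Q\xrightarrow{w_3}P'\langle\!\langle Q'$; (v) if $P\xrightarrow{R:w_1}P'$ and $Q\xrightarrow{w_2}Q'$, or $P\xrightarrow{w_1}P'$ and $Q\xrightarrow{R:w_2}Q'$, or $P\xrightarrow{R:w_1}P'$ and $Q\xrightarrow{R:w_2}Q'$, then $P\langle\!\langle Q\xrightarrow{R:w_3}P'\langle\!\langle Q'$; where $w_3=w_1\langle\!\langle w_2$ must be defined. Node expressions are $ip:P:R$. Their transitions are: - $P\xrightarrow{dsts:\mathbf{*cast}(m)}P'$ gives the same label on the node; - $P\xrightarrow{\mathbf{receive}(m)}P'$ gives $\{ip\}\neg\emptyset:\mathbf{arrive}(m)$;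 - $P\xrightarrow{\mathbf{deliver}(d)}P'$ gives $ip{:}\mathbf{deliver}(d)$; - always $ip:P:R\xrightarrow{\emptyset\neg\{ip\}:\mathbf{arrive}(m)}ip:P:R$; - $\tau$ passes through; - $P\xrightarrow{w_1}P'$, or $P\xrightarrow{R:w_1}P'$ with $R$ the node's range, gives $\mathrm{tick}$; - $\mathbf{connect}(ip,ip')$ / $\mathbf{disconnect}(ip,ip')$ add $ip'$ to / remove $ip'$ from $R$. Partial networks: $M::=ip:P:R\mid M\|M$. Rules: (a) if $M\xrightarrow{R:\mathbf{*cast}(m)}M'$ and $N\xrightarrow{H\neg K:\mathbf{arrive}(m)}N'$ with $H\subseteq R$ and $K\cap R=\emptyset$, then $M\|N\xrightarrow{R:\mathbf{*cast}(m)}M'\|N'$ and $N\|M\xrightarrow{R:\mathbf{*cast}(m)}N'\|M'$; (b) if $M\xrightarrow{H\neg K:\mathbf{arrive}(m)}M'$ and $N\xrightarrow{H'\neg K':\mathbf{arrive}(m)}N'$, then $M\|N\xrightarrow{(H\cup H')\neg(K\cup K'):\mathbf{arrive}(m)}M'\|N'$; (c) if $M\xrightarrow{\mathrm{tick}}M'$ and $N\xrightarrow{\mathrm{tick}}N'$, then $M\|N\xrightarrow{\mathrm{tick}}M'\|N'$; (d) for $a\in\{ip{:}\mathbf{deliver}(d),\tau,\mathbf{connect}(ip,ip'),\mathbf{disconnect}(ip,ip')\}$, if $M\xrightarrow{a}M'$ then $M\|N\xrightarrow{a}M'\|N$, and if $N\xrightarrow{a}N'$ then $M\|N\xrightarrow{a}M\|N'$.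 *)

theory Defs
  imports Main
begin

text \<open>
  The type variables \<open>'ip\<close>, \<open>'m\<close>, \<open>'d\<close>, \<open>'v\<close>, \<open>'p\<close> stand for addresses, messages, data,
  valuations and sequential process expressions. The transition relation \<open>sq\<close> of the sequential
  components \<open>\<xi>,p\<close> is a parameter of the semantics; only its label set is fixed.
\<close>

datatype wait_act = W | WR | WS | WRS

datatype ('ip, 'm, 'd) pp_act =
    Tau
  | Cast "'ip set" 'm
  | Send 'm
  | Deliver 'd
  | Receive 'm
  | Wait wait_act
  | Transmit "'ip set" wait_act

datatype ('v, 'p) pp =
    Seq 'v 'p
  | Par "('v, 'p) pp" "('v, 'p) pp"  (infix "\<langle>\<langle>" 60)

fun wait_par :: "wait_act \<Rightarrow> wait_act \<Rightarrow> wait_act option" where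
  "wait_par W W = Some W"
| "wait_par W WR = Some WR"
| "wait_par W WS = Some W"
| "wait_par W WRS = Some WR"
| "wait_par WR W = Some W"
| "wait_par WR WR = Some WR"
| "wait_par WS W = Some WS"
| "wait_par WS WR = Some WRS"
| "wait_par WS WS = Some WS"
| "wait_par WS WRS = Some WRS"
| "wait_par WRS W = Some WS"
| "wait_par WRS WR = Some WRS"
| "wait_par _ _ = None"

inductive pp_step ::
  "('v \<times> 'p \<Rightarrow> ('ip, 'm, 'd) pp_act \<Rightarrow> 'v \<times> 'p \<Rightarrow> bool) \<Rightarrow>
    ('v, 'p) pp \<Rightarrow> ('ip, 'm, 'd) pp_act \<Rightarrow> ('v, 'p) pp \<Rightarrow> bool"
  for sq
where
  seq: "sq (\<xi>, p) a (\<xi>', p') \<Longrightarrow> pp_step sq (Seq \<xi> p) a (Seq \<xi>' p')"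
| par_left:
    "\<lbrakk>pp_step sq P a P';
      \<And>m. a \<noteq> Receive m; \<And>w\<^sub>1. a \<noteq> Wait w\<^sub>1; \<And>R w\<^sub>1. a \<noteq> Transmit R w\<^sub>1\<rbrakk> \<Longrightarrow>
     pp_step sq (P \<langle>\<langle> Q) a (P' \<langle>\<langle> Q)"
| par_right:
    "\<lbrakk>pp_step sq Q a Q';
      \<And>m. a \<noteq> Send m; \<And>w\<^sub>1. a \<noteq> Wait w\<^sub>1; \<And>R w\<^sub>1. a \<noteq> Transmit R w\<^sub>1\<rbrakk> \<Longrightarrow>
     pp_step sq (P \<langle>\<langle> Q) a (P \<langle>\<langle> Q')"
| par_comm:
    "\<lbrakk>pp_step sq P (Receive m) P'; pp_step sq Q (Send m) Q'\<rbrakk> \<Longrightarrow>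
     pp_step sq (P \<langle>\<langle> Q) Tau (P' \<langle>\<langle> Q')"
| par_wait:
    "\<lbrakk>pp_step sq P (Wait w\<^sub>1) P'; pp_step sq Q (Wait w\<^sub>2) Q';
      wait_par w\<^sub>1 w\<^sub>2 = Some w\<^sub>3\<rbrakk> \<Longrightarrow>
     pp_step sq (P \<langle>\<langle> Q) (Wait w\<^sub>3) (P' \<langle>\<langle> Q')"
| par_transmit_left:
    "\<lbrakk>pp_step sq P (Transmit R w\<^sub>1) P'; pp_step sq Q (Wait w\<^sub>2) Q';
      wait_par w\<^sub>1 w\<^sub>2 = Some w\<^sub>3\<rbrakk> \<Longrightarrow>
     pp_step sq (P \<langle>\<langle> Q) (Transmit R w\<^sub>3) (P' \<langle>\<langle> Q')"
| par_transmit_right: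
    "\<lbrakk>pp_step sq P (Wait w\<^sub>1) P'; pp_step sq Q (Transmit R w\<^sub>2) Q';
      wait_par w\<^sub>1 w\<^sub>2 = Some w\<^sub>3\<rbrakk> \<Longrightarrow>
     pp_step sq (P \<langle>\<langle> Q) (Transmit R w\<^sub>3) (P' \<langle>\<langle> Q')"
| par_transmit_both:
    "\<lbrakk>pp_step sq P (Transmit R w\<^sub>1) P'; pp_step sq Q (Transmit R w\<^sub>2) Q';
      wait_par w\<^sub>1 w\<^sub>2 = Some w\<^sub>3\<rbrakk> \<Longrightarrow>
     pp_step sq (P \<langle>\<langle> Q) (Transmit R w\<^sub>3) (P' \<langle>\<langle> Q')"

text \<open>\<open>NArrive H K m\<close> is the label \<open>H\<not>K:arrive(m)\<close>.\<close>

datatype ('ip, 'm, 'd) net_act =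
    NCast "'ip set" 'm
  | NArrive "'ip set" "'ip set" 'm
  | NDeliver 'ip 'd
  | NTau
  | Tick
  | Connect 'ip 'ip
  | Disconnect 'ip 'ip

text \<open>\<open>Node ip P R\<close> is \<open>ip:P:R\<close>, where \<open>R\<close> is the transmission range.\<close>

datatype ('ip, 'v, 'p) net =
    Node 'ip "('v, 'p) pp" "'ip set"
  | NPar "('ip, 'v, 'p) net" "('ip, 'v, 'p) net"  (infix "\<parallel>" 60)

inductive net_step ::
  "('v \<times> 'p \<Rightarrow> ('ip, 'm, 'd) pp_act \<Rightarrow> 'v \<times> 'p \<Rightarrow> bool) \<Rightarrow>
    ('ip, 'v, 'p) net \<Rightarrow> ('ip, 'm, 'd) net_act \<Rightarrow> ('ip, 'v, 'p) net \<Rightarrow> bool"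
  for sq
where
  node_cast:
    "pp_step sq P (Cast dsts m) P' \<Longrightarrow> net_step sq (Node ip P R) (NCast dsts m) (Node ip P' R)"
| node_receive:
    "pp_step sq P (Receive m) P' \<Longrightarrow> net_step sq (Node ip P R) (NArrive {ip} {} m) (Node ip P' R)"
| node_deliver:
    "pp_step sq P (Deliver d) P' \<Longrightarrow> net_step sq (Node ip P R) (NDeliver ip d) (Node ip P' R)"
| node_miss:
    "net_step sq (Node ip P R) (NArrive {} {ip} m) (Node ip P R)"
| node_tau:
    "pp_step sq P Tau P' \<Longrightarrow> net_step sq (Node ip P R) NTau (Node ip P' R)"
| node_wait:
    "pp_step sq P (Wait w\<^sub>1) P' \<Longrightarrow> net_step sq (Node ip P R) Tick (Node ip P' R)"
| node_transmit:
    "pp_step sq P (Transmit R w\<^sub>1) P' \<Longrightarrow> net_step sq (Node ip P R) Tick (Node ip P' R)"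
| node_connect:
    "net_step sq (Node ip P R) (Connect ip ip') (Node ip P (R \<union> {ip'}))"
| node_disconnect:
    "net_step sq (Node ip P R) (Disconnect ip ip') (Node ip P (R - {ip'}))"
| net_cast_left:
    "\<lbrakk>net_step sq M (NCast R m) M'; net_step sq N (NArrive H K m) N'; H \<subseteq> R; K \<inter> R = {}\<rbrakk> \<Longrightarrow>
     net_step sq (M \<parallel> N) (NCast R m) (M' \<parallel> N')"
| net_cast_right:
    "\<lbrakk>net_step sq M (NCast R m) M'; net_step sq N (NArrive H K m) N'; H \<subseteq> R; K \<inter> R = {}\<rbrakk> \<Longrightarrow>
     net_step sq (N \<parallel> M) (NCast R m) (N' \<parallel> M')"
| net_arrive:
    "\<lbrakk>net_step sq M (NArrive H K m) M'; net_step sq N (NArrive H' K' m) N'\<rbrakk> \<Longrightarrow>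
     net_step sq (M \<parallel> N) (NArrive (H \<union> H') (K \<union> K') m) (M' \<parallel> N')"
| net_tick:
    "\<lbrakk>net_step sq M Tick M'; net_step sq N Tick N'\<rbrakk> \<Longrightarrow>
     net_step sq (M \<parallel> N) Tick (M' \<parallel> N')"
| net_left:
    "\<lbrakk>net_step sq M a M';
      (\<exists>ip d. a = NDeliver ip d) \<or> a = NTau \<or>
      (\<exists>ip ip'. a = Connect ip ip') \<or> (\<exists>ip ip'. a = Disconnect ip ip')\<rbrakk> \<Longrightarrow>
     net_step sq (M \<parallel> N) a (M' \<parallel> N)"
| net_right:
    "\<lbrakk>net_step sq N a N';
      (\<exists>ip d. a = NDeliver ip d) \<or> a = NTau \<or>
      (\<exists>ip ip'. a = Connect ip ip') \<or> (\<exists>ip ip'. a = Disconnect ip ip')\<rbrakk> \<Longrightarrow>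
     net_step sq (M \<parallel> N) a (M \<parallel> N')"

definition strong_bisimulation ::
  "('s \<Rightarrow> 'a \<Rightarrow> 's \<Rightarrow> bool) \<Rightarrow> ('s \<Rightarrow> 's \<Rightarrow> bool) \<Rightarrow> bool"
where
  "strong_bisimulation step B \<longleftrightarrow>
    (\<forall>s t. B s t \<longrightarrow>
      (\<forall>a s'. step s a s' \<longrightarrow> (\<exists>t'. step t a t' \<and> B s' t')) \<and>
      (\<forall>a t'. step t a t' \<longrightarrow> (\<exists>s'. step s a s' \<and> B s' t')))"

definition strongly_bisimilar :: "('s \<Rightarrow> 'a \<Rightarrow> 's \<Rightarrow> bool) \<Rightarrow> 's \<Rightarrow> 's \<Rightarrow> bool" where
  "strongly_bisimilar step s t \<longleftrightarrow> (\<exists>B. strong_bisimulation step B \<and> B s t)"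

end

(* The pairs of terms that differ by reassociating (or commuting) fixed components form a strong
   bisimulation, because a parallel composition never changes shape and the conditions under which
   the components step together do not depend on the bracketing. For wait actions, read r and s as
   two flags "ready to receive" and "ready to send": u \<langle>\<langle> v is undefined iff u has r and v has s,
   and otherwise takes s from u and r from v, so it is associative as a partial operation. For a
   broadcast, H \<subseteq> R and K \<inter> R = {} hold for a union of arrive labels iff they hold for each part. *)

theory Submission
  imports Defs
begin

text \<open>In flag terms, \<open>x\<close> inherits "ready to receive" from \<open>v\<close>, and
  \<open>z\<close> inherits "ready to send" from \<open>v\<close>. So both bracketings are defined
  under the same two conditions, one on \<open>u\<close> and \<open>v\<close>, the other on
  \<open>v\<close> and \<open>w\<close>.\<close>

lemma wait_par_assocD:
  "wait_par u v = Some x \<Longrightarrow> wait_par x w = Some y \<Longrightarrow>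
   \<exists>z. wait_par v w = Some z \<and> wait_par u z = Some y"
  by (cases u; cases v; cases w; auto)

lemma wait_par_assocD':
  "wait_par v w = Some z \<Longrightarrow> wait_par u z = Some y \<Longrightarrow>
   \<exists>x. wait_par u v = Some x \<and> wait_par x w = Some y"
  by (cases u; cases v; cases w; auto)

inductive_cases pp_step_ParE: "pp_step sq (P \<langle>\<langle> Q) a T"

text \<open>Fixing the shape of the target turns rule inversion into one equation per label, so that
  nested compositions can be unfolded by rewriting alone.\<close>

lemma pp_step_Par_simps:
  "pp_step sq (P \<langle>\<langle> Q) Tau (P' \<langle>\<langle> Q') \<longleftrightarrow>
    pp_step sq P Tau P' \<and> Q' = Q \<or> pp_step sq Q Tau Q' \<and> P' = P \<or>
    (\<exists>m. pp_step sq P (Receive m) P' \<and> pp_step sq Q (Send m) Q')"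
  "pp_step sq (P \<langle>\<langle> Q) (Cast R m) (P' \<langle>\<langle> Q') \<longleftrightarrow>
    pp_step sq P (Cast R m) P' \<and> Q' = Q \<or> pp_step sq Q (Cast R m) Q' \<and> P' = P"
  "pp_step sq (P \<langle>\<langle> Q) (Send m) (P' \<langle>\<langle> Q') \<longleftrightarrow> pp_step sq P (Send m) P' \<and> Q' = Q"
  "pp_step sq (P \<langle>\<langle> Q) (Deliver d) (P' \<langle>\<langle> Q') \<longleftrightarrow>
    pp_step sq P (Deliver d) P' \<and> Q' = Q \<or> pp_step sq Q (Deliver d) Q' \<and> P' = P"
  "pp_step sq (P \<langle>\<langle> Q) (Receive m) (P' \<langle>\<langle> Q') \<longleftrightarrow> pp_step sq Q (Receive m) Q' \<and> P' = P"
  "pp_step sq (P \<langle>\<langle> Q) (Wait w) (P' \<langle>\<langle> Q') \<longleftrightarrow>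
    (\<exists>u v. pp_step sq P (Wait u) P' \<and> pp_step sq Q (Wait v) Q' \<and> wait_par u v = Some w)"
  "pp_step sq (P \<langle>\<langle> Q) (Transmit R w) (P' \<langle>\<langle> Q') \<longleftrightarrow>
    (\<exists>u v. (pp_step sq P (Transmit R u) P' \<and> pp_step sq Q (Wait v) Q' \<or>
            pp_step sq P (Wait u) P' \<and> pp_step sq Q (Transmit R v) Q' \<or>
            pp_step sq P (Transmit R u) P' \<and> pp_step sq Q (Transmit R v) Q') \<and>
           wait_par u v = Some w)"
  by (auto elim!: pp_step_ParE intro: pp_step.intros)

text \<open>A composition sends only through its left argument and receives only through its right
  one. Hence under either bracketing the only handshakes are \<open>P\<close> receiving from
  \<open>Q\<close> and \<open>Q\<close> receiving from \<open>S\<close>.\<close>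

lemma pp_step_Par_assoc:
  "pp_step sq ((P \<langle>\<langle> Q) \<langle>\<langle> S) a ((P' \<langle>\<langle> Q') \<langle>\<langle> S') \<longleftrightarrow>
   pp_step sq (P \<langle>\<langle> (Q \<langle>\<langle> S)) a (P' \<langle>\<langle> (Q' \<langle>\<langle> S'))"
proof (cases a)
  case (Wait w)
  show ?thesis
    unfolding Wait pp_step_Par_simps by (blast dest: wait_par_assocD wait_par_assocD')
next
  case (Transmit R w)
  show ?thesis
    unfolding Transmit pp_step_Par_simps
    \<comment> \<open>Each direction splits into one case per nonempty set of transmitting
      components. Reassociating the wait labels first leaves only the matching disjunct to be
      found.\<close>
    by (intro iffI; elim exE conjE disjE) (drule (1) wait_par_assocD wait_par_assocD', blast)+
qed (auto simp: pp_step_Par_simps)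

lemma pp_step_Par_assoc_shape:
  "pp_step sq ((P \<langle>\<langle> Q) \<langle>\<langle> S) a T \<Longrightarrow> \<exists>P' Q' S'. T = (P' \<langle>\<langle> Q') \<langle>\<langle> S'"
  "pp_step sq (P \<langle>\<langle> (Q \<langle>\<langle> S)) a T \<Longrightarrow> \<exists>P' Q' S'. T = P' \<langle>\<langle> (Q' \<langle>\<langle> S')"
  by (auto elim!: pp_step_ParE)

inductive_cases net_step_NParE: "net_step sq (M \<parallel> N) a T"

lemma net_step_NPar_simps:
  "net_step sq (M \<parallel> N) Tick (M' \<parallel> N') \<longleftrightarrow> net_step sq M Tick M' \<and> net_step sq N Tick N'"
  "net_step sq (M \<parallel> N) (NDeliver ip d) (M' \<parallel> N') \<longleftrightarrow>
    net_step sq M (NDeliver ip d) M' \<and> N' = N \<or> net_step sq N (NDeliver ip d) N' \<and> M' = M"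
  "net_step sq (M \<parallel> N) NTau (M' \<parallel> N') \<longleftrightarrow>
    net_step sq M NTau M' \<and> N' = N \<or> net_step sq N NTau N' \<and> M' = M"
  "net_step sq (M \<parallel> N) (Connect ip ip') (M' \<parallel> N') \<longleftrightarrow>
    net_step sq M (Connect ip ip') M' \<and> N' = N \<or> net_step sq N (Connect ip ip') N' \<and> M' = M"
  "net_step sq (M \<parallel> N) (Disconnect ip ip') (M' \<parallel> N') \<longleftrightarrow>
    net_step sq M (Disconnect ip ip') M' \<and> N' = N \<or>
    net_step sq N (Disconnect ip ip') N' \<and> M' = M"
  by (auto elim!: net_step_NParE intro: net_step.intros)

text \<open>The two unions do not determine their parts, so this label gets an elimination rule;
  \<open>net_arrive\<close> serves as the converse.\<close>

lemma net_step_NPar_NArriveE: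
  assumes "net_step sq (M \<parallel> N) (NArrive H K m) (M' \<parallel> N')"
  obtains H\<^sub>1 K\<^sub>1 H\<^sub>2 K\<^sub>2 where "H = H\<^sub>1 \<union> H\<^sub>2" "K = K\<^sub>1 \<union> K\<^sub>2"
    "net_step sq M (NArrive H\<^sub>1 K\<^sub>1 m) M'" "net_step sq N (NArrive H\<^sub>2 K\<^sub>2 m) N'"
  using assms by (auto elim: net_step_NParE)

text \<open>Hides the sets \<open>H\<close> and \<open>K\<close>, which the label of a cast does not
  record. What remains is a relation between networks that can be analysed componentwise.\<close>

definition admits_cast ::
  "('v \<times> 'p \<Rightarrow> ('ip, 'm, 'd) pp_act \<Rightarrow> 'v \<times> 'p \<Rightarrow> bool) \<Rightarrow> 'ip set \<Rightarrow> 'm \<Rightarrow>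
    ('ip, 'v, 'p) net \<Rightarrow> ('ip, 'v, 'p) net \<Rightarrow> bool"
where
  "admits_cast sq R m M M' \<longleftrightarrow>
    (\<exists>H K. H \<subseteq> R \<and> K \<inter> R = {} \<and> net_step sq M (NArrive H K m) M')"

lemma net_step_NPar_NCast:
  "net_step sq (M \<parallel> N) (NCast R m) (M' \<parallel> N') \<longleftrightarrow>
    net_step sq M (NCast R m) M' \<and> admits_cast sq R m N N' \<or>
    admits_cast sq R m M M' \<and> net_step sq N (NCast R m) N'"
  unfolding admits_cast_def by (auto elim!: net_step_NParE intro: net_step.intros)

text \<open>Together with \<open>net_step_NPar_NCast\<close> this makes a cast of a nested network a
  propositional condition: one component casts and all others admit it. Rebracketing then needs only
  propositional reasoning.\<close>

lemma admits_cast_NPar: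
  "admits_cast sq R m (M \<parallel> N) (M' \<parallel> N') \<longleftrightarrow> admits_cast sq R m M M' \<and> admits_cast sq R m N N'"
proof
  assume "admits_cast sq R m (M \<parallel> N) (M' \<parallel> N')"
  then show "admits_cast sq R m M M' \<and> admits_cast sq R m N N'"
    unfolding admits_cast_def
    by (elim exE conjE net_step_NPar_NArriveE) (simp add: Int_Un_distrib2, blast)
next
  assume "admits_cast sq R m M M' \<and> admits_cast sq R m N N'"
  then obtain H\<^sub>1 K\<^sub>1 H\<^sub>2 K\<^sub>2 where "H\<^sub>1 \<subseteq> R" "K\<^sub>1 \<inter> R = {}" "H\<^sub>2 \<subseteq> R" "K\<^sub>2 \<inter> R = {}"
    and steps: "net_step sq M (NArrive H\<^sub>1 K\<^sub>1 m) M'" "net_step sq N (NArrive H\<^sub>2 K\<^sub>2 m) N'"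
    unfolding admits_cast_def by blast
  then have "H\<^sub>1 \<union> H\<^sub>2 \<subseteq> R" "(K\<^sub>1 \<union> K\<^sub>2) \<inter> R = {}"
    by blast+
  with net_arrive[OF steps] show "admits_cast sq R m (M \<parallel> N) (M' \<parallel> N')"
    unfolding admits_cast_def by blast
qed

lemma net_step_NPar_commute:
  "net_step sq (M \<parallel> N) a (M' \<parallel> N') \<longleftrightarrow> net_step sq (N \<parallel> M) a (N' \<parallel> M')"
proof (cases a)
  case (NArrive H K m)
  \<comment> \<open>The implication is stated for arbitrary components, so exchanging their roles
    also yields the reverse direction.\<close>
  have "net_step sq (N \<parallel> M) (NArrive H K m) (N' \<parallel> M')"
    if step: "net_step sq (M \<parallel> N) (NArrive H K m) (M' \<parallel> N')" for M N M' N'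
  proof -
    from step obtain H\<^sub>1 K\<^sub>1 H\<^sub>2 K\<^sub>2 where "H = H\<^sub>1 \<union> H\<^sub>2" "K = K\<^sub>1 \<union> K\<^sub>2"
      "net_step sq M (NArrive H\<^sub>1 K\<^sub>1 m) M'" "net_step sq N (NArrive H\<^sub>2 K\<^sub>2 m) N'"
      by (rule net_step_NPar_NArriveE)
    then show ?thesis
      using net_arrive[of sq N H\<^sub>2 K\<^sub>2 m N' M H\<^sub>1 K\<^sub>1 M'] by (simp add: Un_commute)
  qed
  then show ?thesis
    unfolding NArrive by blast
qed (auto simp: net_step_NPar_simps net_step_NPar_NCast)

lemma net_step_NPar_assoc:
  "net_step sq ((M \<parallel> N) \<parallel> L) a ((M' \<parallel> N') \<parallel> L') \<longleftrightarrow>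
   net_step sq (M \<parallel> (N \<parallel> L)) a (M' \<parallel> (N' \<parallel> L'))"
proof (cases a)
  case (NCast R m)
  then show ?thesis
    by (auto simp: net_step_NPar_NCast admits_cast_NPar)
next
  case (NArrive H K m)
  show ?thesis
    unfolding NArrive
  proof
    assume "net_step sq ((M \<parallel> N) \<parallel> L) (NArrive H K m) ((M' \<parallel> N') \<parallel> L')"
    then show "net_step sq (M \<parallel> (N \<parallel> L)) (NArrive H K m) (M' \<parallel> (N' \<parallel> L'))"
      \<comment> \<open>The unions in the label are rebracketed to nest like the target network, so
        that \<open>net_arrive\<close> matches at both levels.\<close>
      by (elim net_step_NPar_NArriveE) (simp add: Un_assoc net_arrive)
  next
    assume "net_step sq (M \<parallel> (N \<parallel> L)) (NArrive H K m) (M' \<parallel> (N' \<parallel> L'))"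
    then show "net_step sq ((M \<parallel> N) \<parallel> L) (NArrive H K m) ((M' \<parallel> N') \<parallel> L')"
      by (elim net_step_NPar_NArriveE) (simp add: Un_assoc[symmetric] net_arrive)
  qed
qed (auto simp: net_step_NPar_simps)

lemma net_step_NPar_shape:
  "net_step sq (M \<parallel> N) a T \<Longrightarrow> \<exists>M' N'. T = M' \<parallel> N'"
  "net_step sq ((M \<parallel> N) \<parallel> L) a T \<Longrightarrow> \<exists>M' N' L'. T = (M' \<parallel> N') \<parallel> L'"
  "net_step sq (M \<parallel> (N \<parallel> L)) a T \<Longrightarrow> \<exists>M' N' L'. T = M' \<parallel> (N' \<parallel> L')"
  by (auto elim!: net_step_NParE)

text \<open>Common pattern of the three laws: \<open>x\<close> is the tuple of components,
  \<open>f\<close> and \<open>g\<close> arrange it in two ways. Relating \<open>f x\<close> to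
  \<open>g x\<close> for every \<open>x\<close> is a bisimulation, since a step from either
  arrangement stays in its image and is matched with the same new tuple.\<close>

lemma strongly_bisimilar_imagesI:
  assumes "\<And>x a s'. step (f x) a s' \<Longrightarrow> \<exists>y. s' = f y"
    and "\<And>x a s'. step (g x) a s' \<Longrightarrow> \<exists>y. s' = g y"
    and "\<And>x a y. step (f x) a (f y) \<longleftrightarrow> step (g x) a (g y)"
  shows "strongly_bisimilar step (f x) (g x)"
proof -
  have "strong_bisimulation step (\<lambda>s t. \<exists>x. s = f x \<and> t = g x)"
    unfolding strong_bisimulation_def using assms by metis
  then show ?thesis
    unfolding strongly_bisimilar_def by blast
qed

lemma strongly_bisimilar_Par_assoc:
  "strongly_bisimilar (pp_step sq) ((P \<langle>\<langle> Q) \<langle>\<langle> S) (P \<langle>\<langle> (Q \<langle>\<langle> S))"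
proof -
  have "strongly_bisimilar (pp_step sq) ((\<lambda>(P, Q, S). (P \<langle>\<langle> Q) \<langle>\<langle> S) (P, Q, S)) ((\<lambda>(P, Q, S). P \<langle>\<langle> (Q \<langle>\<langle> S)) (P, Q, S))"
    by (rule strongly_bisimilar_imagesI)
       (auto simp: pp_step_Par_assoc dest: pp_step_Par_assoc_shape)
  then show ?thesis
    by simp
qed

lemma strongly_bisimilar_NPar_assoc:
  "strongly_bisimilar (net_step sq) ((M \<parallel> N) \<parallel> L) (M \<parallel> (N \<parallel> L))"
proof -
  have "strongly_bisimilar (net_step sq) ((\<lambda>(M, N, L). (M \<parallel> N) \<parallel> L) (M, N, L)) ((\<lambda>(M, N, L). M \<parallel> (N \<parallel> L)) (M, N, L))"
    by (rule strongly_bisimilar_imagesI)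
       (auto simp: net_step_NPar_assoc dest: net_step_NPar_shape(2,3))
  then show ?thesis
    by simp
qed

lemma strongly_bisimilar_NPar_commute:
  "strongly_bisimilar (net_step sq) (M \<parallel> N) (N \<parallel> M)"
proof -
  have "strongly_bisimilar (net_step sq) ((\<lambda>(M, N). M \<parallel> N) (M, N)) ((\<lambda>(M, N). N \<parallel> M) (M, N))"
    \<comment> \<open>The commutation equation is permutative, so the simplifier applies it as an
      ordered rewrite rule and does not loop.\<close>
    by (rule strongly_bisimilar_imagesI)
       (auto simp: net_step_NPar_commute dest: net_step_NPar_shape(1))
  then show ?thesis
    by simp
qed

theorem theorem5:
  fixes sq :: "'v \<times> 'p \<Rightarrow> ('ip, 'm, 'd) pp_act \<Rightarrow> 'v \<times> 'p \<Rightarrow> bool"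
  shows "(\<forall>P Q S :: ('v, 'p) pp.
            strongly_bisimilar (pp_step sq) ((P \<langle>\<langle> Q) \<langle>\<langle> S) (P \<langle>\<langle> (Q \<langle>\<langle> S))) \<and>
         (\<forall>M\<^sub>1 M\<^sub>2 M\<^sub>3 :: ('ip, 'v, 'p) net.
            strongly_bisimilar (net_step sq) ((M\<^sub>1 \<parallel> M\<^sub>2) \<parallel> M\<^sub>3) (M\<^sub>1 \<parallel> (M\<^sub>2 \<parallel> M\<^sub>3))) \<and>
         (\<forall>M\<^sub>1 M\<^sub>2 :: ('ip, 'v, 'p) net.
            strongly_bisimilar (net_step sq) (M\<^sub>1 \<parallel> M\<^sub>2) (M\<^sub>2 \<parallel> M\<^sub>1))"
  by (intro conjI allI strongly_bisimilar_Par_assoc strongly_bisimilar_NPar_assoc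
      strongly_bisimilar_NPar_commute)

end
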